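(* Fix $k\ge1$ and $R<\infty$. Let $\Psi^y=\{\psi^y_1,\dots,\psi^y_{q_y}\}\subset\ell_1(\mathbb N)$ be output filters with $\|\psi^y_r\|_1\le1$ and $\Psi^u=\{\psi^u_1,\dots,\psi^u_{q_u}\}\subset\ell_1(\mathbb N_0)$ be input filters with $\|\psi^u_a\|_1\le1$, with total filter count $q_y+q_u<k$. Then there exist a $k$-dimensional real linear dynamical system $(A,B,C)$ with scalar input and scalar output, with $\|A\|_\infty,\|B\|_\infty,\|C\|_\infty\le1$, and a bounded input sequence $(u_t)_{t\ge1}$ whose resulting outputs satisfy $|y_t|\le1$ for all $t\ge1$ (i.e. the input is $1$-controlling), such that $$\liminf_{T\to\infty}\ \inf_{f\in\mathrm{GUF}^R_{\Psi^y,\Psi^u}}\ \frac1T\sum_{t=1}^T|f_t-y_t|^2>0.$$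
   Context: A linear dynamical system $(A,B,C)$ of dimension $k$ with scalar input and output has $A\in\mathbb R^{k\times k}$, $B\in\mathbb R^{k\times1}$, $C\in\mathbb R^{1\times k}$ and evolves as $x_t=Ax_{t-1}+Bu_t$, $y_t=Cx_t$ for $t\ge1$, $x_0=0$. Here $\mathbb N=\{1,2,\dots\}$ (output filters are strictly causal) and $\mathbb N_0=\{0,1,2,\dots\}$. For scalar sequences $u,y$, $$(\psi^y_r*y)_t:=\sum_{\tau=1}^{t-1}\psi^y_{r,\tau}\,y_{t-\tau},\qquad(\psi^u_a*u)_t:=\sum_{\tau=0}^{t-1}\psi^u_{a,\tau}\,u_{t-\tau}.$$ The bounded-coefficient filter predictor class is $$\mathrm{GUF}^R_{\Psi^y,\Psi^u}:=\Bigl\{f:\ f_t=\sum_{r=1}^{q_y}\alpha_r(\psi^y_r*y)_t+\sum_{a=1}^{q_u}\beta_a(\psi^u_a*u)_t,\ \ \sum_{r=1}^{q_y}|\alpha_r|+\sum_{a=1}^{q_u}|\beta_a|\le R\Bigr\},$$ where the coefficients $\alpha_r,\beta_a$ are real and do not depend on $t$. $\|\cdot\|_\infty$ on matrices is the induced $\infty$-norm (maximum absolute row sum). *)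

theory Defs
  imports "HOL-Analysis.Analysis"
begin

definition ell1 :: "nat set \<Rightarrow> (nat \<Rightarrow> real) set" where
  "ell1 I = {\<psi>. (\<lambda>\<tau>. \<bar>\<psi> \<tau>\<bar>) summable_on I}"

definition ell1_norm :: "nat set \<Rightarrow> (nat \<Rightarrow> real) \<Rightarrow> real" where
  "ell1_norm I \<psi> = (\<Sum>\<^sub>\<infinity>\<tau>\<in>I. \<bar>\<psi> \<tau>\<bar>)"

(* Maximum absolute row sum, i.e. the operator norm induced by the sup norms;
   library constant onorm is induced by the Euclidean norms instead. *)
definition matrix_inf_norm :: "real ^ 'n ^ 'm \<Rightarrow> real" where
  "matrix_inf_norm M = Max (range (\<lambda>i. \<Sum>j\<in>UNIV. \<bar>M $ i $ j\<bar>))"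

(* Signals are functions on nat of which only the values at times t >= 1 matter. *)
primrec lds_state ::
    "real ^ 'k ^ 'k \<Rightarrow> real ^ 1 ^ 'k \<Rightarrow> (nat \<Rightarrow> real) \<Rightarrow> nat \<Rightarrow> real ^ 'k" where
  "lds_state A B u 0 = 0"
| "lds_state A B u (Suc t) = A *v lds_state A B u t + B *v vec (u (Suc t))"

definition lds_output ::
    "real ^ 'k ^ 'k \<Rightarrow> real ^ 1 ^ 'k \<Rightarrow> real ^ 'k ^ 1 \<Rightarrow> (nat \<Rightarrow> real) \<Rightarrow> nat \<Rightarrow> real" where
  "lds_output A B C u t = (C *v lds_state A B u t) $ 1"

definition output_conv :: "(nat \<Rightarrow> real) \<Rightarrow> (nat \<Rightarrow> real) \<Rightarrow> nat \<Rightarrow> real" where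
  "output_conv \<psi> y t = (\<Sum>\<tau>\<in>{1..<t}. \<psi> \<tau> * y (t - \<tau>))"

definition input_conv :: "(nat \<Rightarrow> real) \<Rightarrow> (nat \<Rightarrow> real) \<Rightarrow> nat \<Rightarrow> real" where
  "input_conv \<psi> u t = (\<Sum>\<tau>\<in>{0..<t}. \<psi> \<tau> * u (t - \<tau>))"

(* A predictor maps an input signal u, an output signal y and a time t to f_t.
   The filter families are psi_1, ..., psi_q, given as functions on nat. *)
definition GUF ::
    "real \<Rightarrow> nat \<Rightarrow> (nat \<Rightarrow> nat \<Rightarrow> real) \<Rightarrow> nat \<Rightarrow> (nat \<Rightarrow> nat \<Rightarrow> real)
      \<Rightarrow> ((nat \<Rightarrow> real) \<Rightarrow> (nat \<Rightarrow> real) \<Rightarrow> nat \<Rightarrow> real) set" where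
  "GUF R qy \<psi>y qu \<psi>u =
     {(\<lambda>u y t. (\<Sum>r=1..qy. \<alpha> r * output_conv (\<psi>y r) y t)
             + (\<Sum>a=1..qu. \<beta> a * input_conv (\<psi>u a) u t)) | \<alpha> \<beta>.
        (\<Sum>r=1..qy. \<bar>\<alpha> r\<bar>) + (\<Sum>a=1..qu. \<bar>\<beta> a\<bar>) \<le> R}"

end

(* The system is a delay line with impulse response c_0, ..., c_{k-1}, driven by a sparse impulse
   train.  If the impulses are far enough apart, the tails of the filters are negligible, and inside
   each window the error of a predictor with combined filters p (output) and b (input) is almost
   b_j + sum_{i<j} p_{j-i} c_i - c_j for j < k.  It vanishes for all j only if c consists of the
   first k Taylor coefficients of b/(1-p), which depend smoothly on fewer than k parameters; such c
   form a null set, so some small c is never hit.  Compactness of the coefficient set then bounds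
   the squared error of every window below uniformly. *)
theory Submission
  imports Defs
begin

section \<open>Closed-loop impulse responses\<close>

text \<open>These are the Taylor coefficients of \<open>b(z) / (1 - p(z))\<close>, where
  \<open>p(z)\<close> sums \<open>p n * z^n\<close> over \<open>n \<ge> 1\<close>: the only impulse
  response that the combined filters \<open>p\<close> and \<open>b\<close> predict without
  error.\<close>

fun closed_loop_response :: "(nat \<Rightarrow> real) \<Rightarrow> (nat \<Rightarrow> real) \<Rightarrow> nat \<Rightarrow> real" where
  "closed_loop_response p b j = b j + (\<Sum>i<j. p (j - i) * closed_loop_response p b i)"

declare closed_loop_response.simps [simp del]

text \<open>The equation at \<open>j\<close> expresses \<open>c j\<close> through earlier values, so
  vanishing residuals leave a single candidate for each choice of filters.\<close>

lemma closed_loop_response_unique: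
  assumes "\<And>j. j < k \<Longrightarrow> c j = b j + (\<Sum>i<j. p (j - i) * c i)" and "j < k"
  shows "c j = closed_loop_response p b j"
  using assms(2)
proof (induction j rule: less_induct)
  case (less j)
  have "(\<Sum>i<j. p (j - i) * c i) = (\<Sum>i<j. p (j - i) * closed_loop_response p b i)"
    using less by (intro sum.cong) auto
  then show ?case
    using assms(1)[OF less.prems] by (subst closed_loop_response.simps) simp
qed

text \<open>By the recursion each coefficient is a polynomial in finitely many values of
  \<open>p x\<close> and \<open>b x\<close>.\<close>

lemma differentiable_closed_loop_response:
  fixes p b :: "'a::real_normed_vector \<Rightarrow> nat \<Rightarrow> real"
  assumes "\<And>j. (\<lambda>x. p x j) differentiable_on S" "\<And>j. (\<lambda>x. b x j) differentiable_on S"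
  shows "(\<lambda>x. closed_loop_response (p x) (b x) j) differentiable_on S"
proof (induction j rule: less_induct)
  case (less j)
  show ?case
    using assms less unfolding differentiable_on_def
    by (subst closed_loop_response.simps)
      (auto intro!: differentiable_add differentiable_sum differentiable_mult)
qed

section \<open>Delay-line realization\<close>

text \<open>\<open>A\<close> shifts a chain of registers numbered by \<open>e\<close>,
  \<open>B\<close> feeds the input into register 0, and \<open>C\<close> reads the registers with
  weights \<open>c\<close>. Rows of \<open>A\<close> and \<open>B\<close> contain at most one 1, so
  only \<open>C\<close> constrains the size of \<open>c\<close>.\<close>

lemma shift_lds_realization:
  fixes e :: "'k::finite \<Rightarrow> nat" and c :: "nat \<Rightarrow> real"
  assumes e: "bij_betw e UNIV {..<CARD('k)}" and c: "(\<Sum>i<CARD('k). \<bar>c i\<bar>) \<le> 1"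
  obtains A :: "real ^ 'k ^ 'k" and B :: "real ^ 1 ^ 'k" and C :: "real ^ 'k ^ 1"
  where "matrix_inf_norm A \<le> 1" "matrix_inf_norm B \<le> 1" "matrix_inf_norm C \<le> 1"
    "\<And>u t. lds_output A B C u t = (\<Sum>i<CARD('k). if i < t then c i * u (t - i) else 0)"
proof -
  define A :: "real ^ 'k ^ 'k" where "A = (\<chi> i j. if e i = Suc (e j) then 1 else 0)"
  define B :: "real ^ 1 ^ 'k" where "B = (\<chi> i j. if e i = 0 then 1 else 0)"
  define C :: "real ^ 'k ^ 1" where "C = (\<chi> i j. c (e j))"
  have reindex: "(\<Sum>i\<in>UNIV. g (e i)) = (\<Sum>i<CARD('k). g i)" for g :: "nat \<Rightarrow> real"
    using sum.reindex_bij_betw[OF e] .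
  \<comment> \<open>Register \<open>e i\<close> holds the input from \<open>e i\<close> steps ago;
    it is still 0 as long as that time would lie before 1.\<close>
  have state: "lds_state A B u t $ i = (if e i < t then u (t - e i) else 0)" for u t i
  proof (induction t arbitrary: i)
    case 0
    show ?case by simp
  next
    case (Suc t)
    have "e i < CARD('k)"
      using e bij_betwE by blast
    have "(A *v lds_state A B u t) $ i
        = (\<Sum>j\<in>UNIV. if e i = Suc (e j) then (if e j < t then u (t - e j) else 0) else 0)"
      by (simp add: matrix_vector_mult_def Suc) (auto simp: A_def intro!: sum.cong)
    also have "\<dots> = (\<Sum>j<CARD('k). if e i = Suc j then (if j < t then u (t - j) else 0) else 0)"
      using reindex[of "\<lambda>j. if e i = Suc j then (if j < t then u (t - j) else 0) else 0"] .
    also have "\<dots> = (if e i > 0 \<and> e i < Suc t then u (Suc t - e i) else 0)"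
      using \<open>e i < CARD('k)\<close> by (cases "e i") auto
    finally show ?case
      by (auto simp: B_def matrix_vector_mult_def)
  qed
  have "(\<Sum>j\<in>UNIV. \<bar>A $ i $ j\<bar>) \<le> 1" for i
  proof -
    have "(\<Sum>j\<in>UNIV. \<bar>A $ i $ j\<bar>) = (\<Sum>j<CARD('k). if e i = Suc j then 1 else 0)"
      using reindex[of "\<lambda>j. if e i = Suc j then 1 else 0"]
      by (simp add: A_def if_distrib[of abs] cong: if_cong)
    also have "\<dots> \<le> 1"
      by (cases "e i") auto
    finally show ?thesis .
  qed
  then have "matrix_inf_norm A \<le> 1"
    by (auto simp: matrix_inf_norm_def)
  moreover have "matrix_inf_norm B \<le> 1"
    unfolding matrix_inf_norm_def B_def by (subst Max_le_iff) auto
  moreover have "matrix_inf_norm C \<le> 1"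
    using c reindex[of "\<lambda>i. \<bar>c i\<bar>"] by (auto simp: matrix_inf_norm_def C_def)
  moreover have "lds_output A B C u t = (\<Sum>i<CARD('k). if i < t then c i * u (t - i) else 0)" for u t
    using reindex[of "\<lambda>i. if i < t then c i * u (t - i) else 0"]
    by (simp add: lds_output_def matrix_vector_mult_def C_def state if_distrib cong: if_cong)
  ultimately show thesis
    by (rule that)
qed

section \<open>Filter tails\<close>

lemma summable_uniform_tails:
  fixes \<psi> :: "'i \<Rightarrow> nat \<Rightarrow> real"
  assumes "finite I" "\<And>i. i \<in> I \<Longrightarrow> summable (\<lambda>\<tau>. \<bar>\<psi> i \<tau>\<bar>)" "\<epsilon> > 0"
  shows "\<exists>M. \<forall>i\<in>I. \<forall>m\<ge>M. \<forall>n. (\<Sum>\<tau>\<in>{m..<n}. \<bar>\<psi> i \<tau>\<bar>) \<le> \<epsilon>"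
proof -
  have "\<exists>M. \<forall>m\<ge>M. \<forall>n. (\<Sum>\<tau>\<in>{m..<n}. \<bar>\<psi> i \<tau>\<bar>) \<le> \<epsilon>" if "i \<in> I" for i
  proof -
    obtain M where "\<forall>m\<ge>M. \<forall>n. norm (\<Sum>\<tau>\<in>{m..<n}. \<bar>\<psi> i \<tau>\<bar>) < \<epsilon>"
      using assms(2)[OF \<open>i \<in> I\<close>] \<open>\<epsilon> > 0\<close> unfolding summable_Cauchy by blast
    then show ?thesis
      by (auto simp: sum_nonneg intro: less_imp_le)
  qed
  then obtain M where M: "\<And>i m n. i \<in> I \<Longrightarrow> m \<ge> M i \<Longrightarrow> (\<Sum>\<tau>\<in>{m..<n}. \<bar>\<psi> i \<tau>\<bar>) \<le> \<epsilon>"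
    by metis
  \<comment> \<open>The sum of the finitely many individual thresholds serves as a common
    one.\<close>
  have "M i \<le> (\<Sum>i\<in>I. M i)" if "i \<in> I" for i
    using that assms(1) by (intro member_le_sum) auto
  then show ?thesis
    using M by (intro exI[of _ "\<Sum>i\<in>I. M i"]) (blast intro: order_trans)
qed

lemma ell1_imp_summable:
  assumes "\<psi> \<in> ell1 {m..}"
  shows "summable (\<lambda>\<tau>. \<bar>\<psi> \<tau>\<bar>)"
proof -
  have "(\<lambda>\<tau>. \<bar>\<psi> \<tau>\<bar>) summable_on ({m..} \<union> {..<m})"
    using assms by (intro summable_on_union) (auto simp: ell1_def)
  moreover have "{m..} \<union> {..<m} = UNIV"
    by auto
  ultimately show ?thesis
    by (simp add: summable_on_UNIV_nonneg_real_iff)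
qed

text \<open>The signal is silent at lags strictly between \<open>j\<close> and \<open>M\<close>, so
  only lags from \<open>M\<close> on contribute, and there it is at most 1 in absolute
  value.\<close>

lemma tail_convolution_bound:
  fixes p v :: "nat \<Rightarrow> real"
  assumes "\<And>s. s \<ge> 1 \<Longrightarrow> \<bar>v s\<bar> \<le> 1"
    and "\<And>\<tau>. j < \<tau> \<Longrightarrow> \<tau> < M \<Longrightarrow> \<tau> < t \<Longrightarrow> v (t - \<tau>) = 0" and "j < M"
  shows "\<bar>\<Sum>\<tau>\<in>{Suc j..<t}. p \<tau> * v (t - \<tau>)\<bar> \<le> (\<Sum>\<tau>\<in>{M..<t}. \<bar>p \<tau>\<bar>)"
proof -
  have "(\<Sum>\<tau>\<in>{Suc j..<t}. p \<tau> * v (t - \<tau>)) = (\<Sum>\<tau>\<in>{M..<t}. p \<tau> * v (t - \<tau>))"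
    using assms(2,3) by (intro sum.mono_neutral_right) (auto simp: not_le)
  also have "\<bar>\<dots>\<bar> \<le> (\<Sum>\<tau>\<in>{M..<t}. \<bar>p \<tau> * v (t - \<tau>)\<bar>)"
    by (rule sum_abs)
  also have "\<dots> \<le> (\<Sum>\<tau>\<in>{M..<t}. \<bar>p \<tau>\<bar>)"
    using assms(1) by (intro sum_mono) (auto simp: abs_mult intro!: mult_left_le)
  finally show ?thesis .
qed

section \<open>Response and prediction error for an impulse train\<close>

text \<open>Impulses occur at times 1, \<open>N + 1\<close>, \<open>2 * N + 1\<close> and so on. As
  \<open>k \<le> N\<close>, their responses do not overlap: each window repeats \<open>c\<close> and
  then stays silent.\<close>

lemma impulse_train_output:
  fixes c :: "nat \<Rightarrow> real"
  assumes "k \<le> N" "t \<ge> 1"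
  shows "(\<Sum>i<k. if i < t then c i * of_bool (N dvd (t - i - 1)) else 0)
    = (if (t - 1) mod N < k then c ((t - 1) mod N) else 0)"
proof -
  have "(i < t \<and> N dvd (t - i - 1)) \<longleftrightarrow> i = (t - 1) mod N" if "i < k" for i
  proof
    assume *: "i < t \<and> N dvd (t - i - 1)"
    then obtain q where "t - i - 1 = N * q" by blast
    then have "t - 1 = N * q + i" using * by simp
    then show "i = (t - 1) mod N" using that assms by simp
  next
    assume *: "i = (t - 1) mod N"
    then have "i \<le> t - 1" by simp
    moreover have "N dvd (t - 1 - i)" using * by (simp only: dvd_minus_mod)
    ultimately show "i < t \<and> N dvd (t - i - 1)" using assms by auto
  qed
  then have "(\<Sum>i<k. if i < t then c i * of_bool (N dvd (t - i - 1)) else 0)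
    = (\<Sum>i<k. if i = (t - 1) mod N then c i else 0)"
    by (intro sum.cong) auto
  then show ?thesis by simp
qed

text \<open>Seen from offset \<open>j\<close> of window \<open>m\<close>, lags up to
  \<open>j\<close> stay in this window and give the main term; larger lags below \<open>M\<close>
  fall into the silent end of the previous window; the remaining lags are paid for by the filter
  tails.\<close>

lemma impulse_train_prediction_error:
  fixes p b c y :: "nat \<Rightarrow> real" and M k j m :: nat
  defines "N \<equiv> M + k" and "u \<equiv> \<lambda>t. of_bool ((M + k) dvd (t - 1))"
    and "t \<equiv> Suc (m * (M + k) + j)"
  assumes "k \<le> M" "j < k" and c: "\<And>i. i < k \<Longrightarrow> \<bar>c i\<bar> \<le> 1"
    and y: "\<And>t. t \<ge> 1 \<Longrightarrow> y t = (if (t - 1) mod N < k then c ((t - 1) mod N) else 0)"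
  shows "\<bar>(output_conv p y t + input_conv b u t - y t)
      - (b j + (\<Sum>i<j. p (j - i) * c i) - c j)\<bar>
    \<le> (\<Sum>\<tau>\<in>{M..<t}. \<bar>p \<tau>\<bar>) + (\<Sum>\<tau>\<in>{M..<t}. \<bar>b \<tau>\<bar>)"
proof -
  have "j < N" "j < M" using assms by auto
  \<comment> \<open>In the first window no lag satisfies both \<open>j < \<tau>\<close> and
    \<open>\<tau> < t\<close>, so a previous window exists. The offset reached there exceeds
    \<open>k\<close> because \<open>\<tau> < M\<close> and \<open>N = M + k\<close>.\<close>
  have gap: "(t - \<tau> - 1) mod N = N + j - \<tau>" if "j < \<tau>" "\<tau> < M" "\<tau> < t" for \<tau>
  proof -
    have "m > 0" using that by (cases m) (auto simp: t_def)
    then obtain n where "m = Suc n" by (cases m) auto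
    then have "t - \<tau> - 1 = n * N + (N + j - \<tau>)" "N + j - \<tau> < N"
      using that by (auto simp: t_def N_def)
    then show ?thesis by simp
  qed
  have y0: "y (t - \<tau>) = 0" if "j < \<tau>" "\<tau> < M" "\<tau> < t" for \<tau>
    using gap[OF that] that by (simp add: y N_def)
  have u0: "u (t - \<tau>) = 0" if "j < \<tau>" "\<tau> < M" "\<tau> < t" for \<tau>
    using gap[OF that] that by (simp add: u_def dvd_eq_mod_eq_0 N_def)
  have offset: "(t - \<tau> - 1) mod N = j - \<tau>" and pos: "t - \<tau> \<ge> 1" if "\<tau> \<le> j" for \<tau>
  proof -
    have "t - \<tau> - 1 = m * N + (j - \<tau>)" using that by (simp add: t_def N_def)
    then have "(t - \<tau> - 1) mod N = (j - \<tau>) mod N" by (simp only: mod_mult_self3)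
    then show "(t - \<tau> - 1) mod N = j - \<tau>" using \<open>j < N\<close> by simp
    show "t - \<tau> \<ge> 1" using that by (simp add: t_def)
  qed
  have yj: "y (t - \<tau>) = c (j - \<tau>)" if "\<tau> \<le> j" for \<tau>
    unfolding y[OF pos[OF that]] offset[OF that] using \<open>j < k\<close> by simp
  \<comment> \<open>The impulse of the current window is met only at lag \<open>j\<close>, hence the
    input filter contributes just \<open>b j\<close>.\<close>
  have uj: "u (t - \<tau>) = of_bool (\<tau> = j)" if "\<tau> \<le> j" for \<tau>
    unfolding u_def dvd_eq_mod_eq_0 N_def[symmetric] offset[OF that] using that by auto
  have "output_conv p y t = (\<Sum>\<tau>\<in>{1..<Suc j}. p \<tau> * y (t - \<tau>)) + (\<Sum>\<tau>\<in>{Suc j..<t}. p \<tau> * y (t - \<tau>))"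
    unfolding output_conv_def by (rule sum.atLeastLessThan_concat[symmetric]) (auto simp: t_def)
  moreover have "(\<Sum>\<tau>\<in>{1..<Suc j}. p \<tau> * y (t - \<tau>)) = (\<Sum>i<j. p (j - i) * c i)"
    using yj by (intro sum.reindex_bij_witness[of _ "\<lambda>i. j - i" "\<lambda>i. j - i"]) auto
  moreover have "input_conv b u t = (\<Sum>\<tau>\<in>{0..<Suc j}. b \<tau> * u (t - \<tau>)) + (\<Sum>\<tau>\<in>{Suc j..<t}. b \<tau> * u (t - \<tau>))"
    unfolding input_conv_def by (rule sum.atLeastLessThan_concat[symmetric]) (auto simp: t_def)
  moreover have "(\<Sum>\<tau>\<in>{0..<Suc j}. b \<tau> * u (t - \<tau>)) = b j"
    using uj by simp
  moreover have "y t = c j"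
    using yj[of 0] by simp
  moreover have "\<bar>\<Sum>\<tau>\<in>{Suc j..<t}. p \<tau> * y (t - \<tau>)\<bar> \<le> (\<Sum>\<tau>\<in>{M..<t}. \<bar>p \<tau>\<bar>)"
    using c y0 \<open>j < M\<close> by (intro tail_convolution_bound) (auto simp: y)
  moreover have "\<bar>\<Sum>\<tau>\<in>{Suc j..<t}. b \<tau> * u (t - \<tau>)\<bar> \<le> (\<Sum>\<tau>\<in>{M..<t}. \<bar>b \<tau>\<bar>)"
    using u0 \<open>j < M\<close> by (intro tail_convolution_bound) (auto simp: u_def)
  ultimately show ?thesis
    by linarith
qed

text \<open>Consecutive windows of length \<open>N\<close> are disjoint, and the nonnegative terms
  after the first \<open>k\<close> positions of each are dropped.\<close>

lemma sum_over_windows_ge: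
  fixes g :: "nat \<Rightarrow> real"
  assumes "\<And>t. g t \<ge> 0" "k \<le> N" "\<And>m. (\<Sum>j<k. g (Suc (m * N + j))) \<ge> d"
  shows "(\<Sum>t=1..n * N. g t) \<ge> real n * d"
proof (induction n)
  case 0
  show ?case by simp
next
  case (Suc n)
  have "{1..Suc n * N} = {1..n * N} \<union> {Suc (n * N)..Suc n * N}" by auto
  then have "(\<Sum>t=1..Suc n * N. g t) = (\<Sum>t=1..n * N. g t) + (\<Sum>t=Suc (n * N)..Suc n * N. g t)"
    by (simp only:) (rule sum.union_disjoint, auto)
  moreover have "(\<Sum>j<k. g (Suc (n * N + j))) = sum g ((\<lambda>j. Suc (n * N + j)) ` {..<k})"
    by (subst sum.reindex) (auto simp: inj_on_def)
  moreover have "\<dots> \<le> (\<Sum>t=Suc (n * N)..Suc n * N. g t)"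
    using assms(1,2) by (intro sum_mono2) auto
  ultimately show ?case
    using Suc assms(3)[of n] by (simp add: algebra_simps)
qed


section \<open>Combined filters\<close>

definition filter_combination :: "nat \<Rightarrow> (nat \<Rightarrow> real) \<Rightarrow> (nat \<Rightarrow> nat \<Rightarrow> real) \<Rightarrow> nat \<Rightarrow> real" where
  "filter_combination q \<gamma> \<psi> \<tau> = (\<Sum>r=1..q. \<gamma> r * \<psi> r \<tau>)"

text \<open>Convolution is linear in the filter, so a predictor in \<open>GUF\<close> acts through
  one output filter and one input filter.\<close>

lemma output_conv_filter_combination:
  "output_conv (filter_combination q \<gamma> \<psi>) y t = (\<Sum>r=1..q. \<gamma> r * output_conv (\<psi> r) y t)"
  unfolding output_conv_def filter_combination_def sum_distrib_left sum_distrib_right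
  by (subst sum.swap) (simp add: mult.assoc)

lemma input_conv_filter_combination:
  "input_conv (filter_combination q \<gamma> \<psi>) u t = (\<Sum>r=1..q. \<gamma> r * input_conv (\<psi> r) u t)"
  unfolding input_conv_def filter_combination_def sum_distrib_left sum_distrib_right
  by (subst sum.swap) (simp add: mult.assoc)

lemma filter_combination_tail:
  assumes "\<And>r. r \<in> {1..q} \<Longrightarrow> (\<Sum>\<tau>\<in>T. \<bar>\<psi> r \<tau>\<bar>) \<le> \<epsilon>"
  shows "(\<Sum>\<tau>\<in>T. \<bar>filter_combination q \<gamma> \<psi> \<tau>\<bar>) \<le> (\<Sum>r=1..q. \<bar>\<gamma> r\<bar>) * \<epsilon>"
proof -
  have "(\<Sum>\<tau>\<in>T. \<bar>filter_combination q \<gamma> \<psi> \<tau>\<bar>) \<le> (\<Sum>\<tau>\<in>T. \<Sum>r=1..q. \<bar>\<gamma> r\<bar> * \<bar>\<psi> r \<tau>\<bar>)"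
    unfolding filter_combination_def
    by (intro sum_mono order_trans[OF sum_abs]) (simp add: abs_mult)
  also have "\<dots> = (\<Sum>r=1..q. \<bar>\<gamma> r\<bar> * (\<Sum>\<tau>\<in>T. \<bar>\<psi> r \<tau>\<bar>))"
    by (subst sum.swap) (simp add: sum_distrib_left)
  also have "\<dots> \<le> (\<Sum>r=1..q. \<bar>\<gamma> r\<bar>) * \<epsilon>"
    unfolding sum_distrib_right using assms by (intro sum_mono mult_left_mono) auto
  finally show ?thesis .
qed

section \<open>An impulse response out of reach of all predictors\<close>

text \<open>A point outside a null image supplies \<open>c\<close>, which makes the squared residual
  positive for all coefficients; \<open>\<delta>\<close> is its minimum over a compact box.\<close>

lemma unpredictable_impulse_response:
  fixes R :: real and \<psi>y \<psi>u :: "nat \<Rightarrow> nat \<Rightarrow> real"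
  assumes less: "qy + qu < CARD('k::finite)" and e: "bij_betw e (UNIV :: 'k set) {..<CARD('k)}"
  obtains c :: "nat \<Rightarrow> real" and \<delta> :: real
  where "(\<Sum>i<CARD('k). \<bar>c i\<bar>) \<le> 1" "\<delta> > 0"
    "\<And>\<alpha> \<beta>. (\<Sum>r=1..qy. \<bar>\<alpha> r\<bar>) + (\<Sum>a=1..qu. \<bar>\<beta> a\<bar>) \<le> R \<Longrightarrow>
      (\<Sum>j<CARD('k). (filter_combination qu \<beta> \<psi>u j
        + (\<Sum>i<j. filter_combination qy \<alpha> \<psi>y (j - i) * c i) - c j)\<^sup>2) \<ge> \<delta>"
proof -
  define d where "d = inv_into UNIV e"
  have ed: "e (d n) = n" if "n < CARD('k)" for n
    using e that unfolding d_def by (simp add: bij_betw_inv_into_right)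
  have de: "d (e i) = i" for i
    using e unfolding d_def by (simp add: bij_betw_inv_into_left)
  have e_less: "e i < CARD('k)" for i
    using e bij_betwE by blast
  \<comment> \<open>Filters are numbered from 1 but coordinates from 0: output filter
    \<open>r\<close> uses coordinate \<open>r - 1\<close>, and the input filters follow after the
    first \<open>qy\<close> coordinates.\<close>
  define p where "p x = filter_combination qy (\<lambda>r. x $ d (r - 1)) \<psi>y" for x :: "real ^ 'k"
  define b where "b x = filter_combination qu (\<lambda>a. x $ d (qy + a - 1)) \<psi>u" for x :: "real ^ 'k"
  (* Coefficients are packed into one vector; as qy + qu < k, the last coordinate stays zero. *)
  define X :: "(nat \<Rightarrow> real) \<Rightarrow> (nat \<Rightarrow> real) \<Rightarrow> real ^ 'k" where
    "X \<alpha> \<beta> = (\<chi> i. if e i < qy then \<alpha> (Suc (e i))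
      else if e i < qy + qu then \<beta> (Suc (e i - qy)) else 0)" for \<alpha> \<beta>
  define S where "S = {x :: real ^ 'k. x $ d (CARD('k) - 1) = 0}"
  have pX: "p (X \<alpha> \<beta>) = filter_combination qy \<alpha> \<psi>y" for \<alpha> \<beta>
    using less by (auto simp: p_def X_def filter_combination_def fun_eq_iff ed intro!: sum.cong)
  have bX: "b (X \<alpha> \<beta>) = filter_combination qu \<beta> \<psi>u" for \<alpha> \<beta>
    using less by (auto simp: b_def X_def filter_combination_def fun_eq_iff ed intro!: sum.cong)
  have XS: "X \<alpha> \<beta> \<in> S" for \<alpha> \<beta>
    using less by (auto simp: S_def X_def ed)
  define F :: "real ^ 'k \<Rightarrow> real ^ 'k" where "F x = (\<chi> i. closed_loop_response (p x) (b x) (e i))" for x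
  have coord: "(\<lambda>x :: real ^ 'k. x $ i) differentiable_on S" for i
    by (simp add: bounded_linear_imp_differentiable_on bounded_linear_vec_nth)
  have "(\<lambda>x. F x $ i) differentiable_on S" for i
    using coord unfolding F_def vec_lambda_beta p_def b_def filter_combination_def
    by (intro differentiable_closed_loop_response)
      (auto simp: differentiable_on_def intro!: differentiable_sum differentiable_mult)
  then have "F differentiable_on S"
    unfolding differentiable_on_def
    by (subst differentiable_componentwise_within) (auto simp: Basis_vec_def inner_axis)
  moreover have "negligible S"
    using negligible_standard_hyperplane[of "axis (d (CARD('k) - 1)) 1 :: real ^ 'k" 0]
    by (auto simp: S_def inner_axis Basis_vec_def)
  \<comment> \<open>A differentiable map between spaces of equal dimension preserves null sets,
    which is why the coefficients live in a hyperplane of the full space.\<close>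
  ultimately have "negligible (F ` S)"
    by (intro negligible_differentiable_image_negligible) auto
  \<comment> \<open>With radius \<open>1 / CARD('k)\<close> each coordinate of \<open>v\<close> is
    at most this value in absolute terms, so the absolute sum of \<open>c\<close> stays within
    1.\<close>
  moreover have "\<not> negligible (ball 0 (1 / CARD('k)) :: (real ^ 'k) set)"
    by (intro open_not_negligible) auto
  ultimately obtain v where v: "norm v < 1 / CARD('k)" "v \<notin> F ` S"
    using negligible_subset by (metis subsetI mem_ball_0)
  define c where "c n = v $ d n" for n
  have "(\<Sum>i<CARD('k). \<bar>c i\<bar>) \<le> (\<Sum>i<CARD('k). 1 / CARD('k))"
    using v(1) component_le_norm_cart[of v] unfolding c_def
    by (intro sum_mono) (meson less_imp_le order_trans)
  then have c_sum: "(\<Sum>i<CARD('k). \<bar>c i\<bar>) \<le> 1"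
    by simp
  define res where "res x j = b x j + (\<Sum>i<j. p x (j - i) * c i) - c j" for x j
  define G where "G x = (\<Sum>j<CARD('k). (res x j)\<^sup>2)" for x
  have res_X: "res (X \<alpha> \<beta>) j = filter_combination qu \<beta> \<psi>u j
      + (\<Sum>i<j. filter_combination qy \<alpha> \<psi>y (j - i) * c i) - c j" for \<alpha> \<beta> j
    by (simp add: res_def pX bX)
  have G_X_pos: "G (X \<alpha> \<beta>) > 0" for \<alpha> \<beta>
  proof (rule ccontr)
    assume "\<not> G (X \<alpha> \<beta>) > 0"
    moreover have "G (X \<alpha> \<beta>) \<ge> 0"
      by (simp add: G_def sum_nonneg)
    ultimately have "G (X \<alpha> \<beta>) = 0" by simp
    then have "res (X \<alpha> \<beta>) j = 0" if "j < CARD('k)" for j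
      using that by (simp add: G_def sum_nonneg_eq_0_iff)
    then have c_eq: "c j = closed_loop_response (p (X \<alpha> \<beta>)) (b (X \<alpha> \<beta>)) j" if "j < CARD('k)" for j
      using that by (intro closed_loop_response_unique[of "CARD('k)"]) (auto simp: res_def)
    then have "F (X \<alpha> \<beta>) = v"
      by (simp add: vec_eq_iff F_def e_less c_def de flip: c_eq)
    then show False
      using v(2) XS by blast
  qed
  \<comment> \<open>\<open>p\<close> and \<open>b\<close> read only the first \<open>qy + qu\<close>
    coordinates, so any \<open>x\<close> may be replaced by a packed vector.\<close>
  have G_pos: "G x > 0" for x
  proof -
    have "p x = p (X (\<lambda>r. x $ d (r - 1)) (\<lambda>a. x $ d (qy + a - 1)))"
      unfolding pX by (simp add: p_def)
    moreover have "b x = b (X (\<lambda>r. x $ d (r - 1)) (\<lambda>a. x $ d (qy + a - 1)))"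
      unfolding bX by (simp add: b_def)
    ultimately show ?thesis
      using G_X_pos[of "\<lambda>r. x $ d (r - 1)" "\<lambda>a. x $ d (qy + a - 1)"] by (simp add: G_def res_def)
  qed
  \<comment> \<open>Taking \<open>\<bar>R\<bar>\<close> keeps the box nonempty for negative
    \<open>R\<close> as well, so the minimum always exists.\<close>
  define K where "K = (cbox (\<chi> i. - \<bar>R\<bar>) (\<chi> i. \<bar>R\<bar>) :: (real ^ 'k) set)"
  have "continuous_on K G"
    unfolding G_def res_def p_def b_def filter_combination_def by (intro continuous_intros)
  moreover have "compact K" "0 \<in> K"
    by (auto simp: K_def mem_box_cart)
  ultimately obtain x0 where x0: "\<And>x. x \<in> K \<Longrightarrow> G x0 \<le> G x"
    using continuous_attains_inf[of K G] by blast
  show thesis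
  proof (rule that[OF c_sum G_pos[of x0]])
    fix \<alpha> \<beta> :: "nat \<Rightarrow> real"
    assume R: "(\<Sum>r=1..qy. \<bar>\<alpha> r\<bar>) + (\<Sum>a=1..qu. \<bar>\<beta> a\<bar>) \<le> R"
    have nonneg: "(\<Sum>r=1..qy. \<bar>\<alpha> r\<bar>) \<ge> 0" "(\<Sum>a=1..qu. \<bar>\<beta> a\<bar>) \<ge> 0"
      by (simp_all add: sum_nonneg)
    have "\<bar>\<alpha> r\<bar> \<le> \<bar>R\<bar>" if "r \<in> {1..qy}" for r
    proof -
      have "\<bar>\<alpha> r\<bar> \<le> (\<Sum>r=1..qy. \<bar>\<alpha> r\<bar>)"
        using that by (intro member_le_sum) auto
      then show ?thesis
        using R nonneg by linarith
    qed
    moreover have "\<bar>\<beta> a\<bar> \<le> \<bar>R\<bar>" if "a \<in> {1..qu}" for a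
    proof -
      have "\<bar>\<beta> a\<bar> \<le> (\<Sum>a=1..qu. \<bar>\<beta> a\<bar>)"
        using that by (intro member_le_sum) auto
      then show ?thesis
        using R nonneg by linarith
    qed
    ultimately have "\<bar>X \<alpha> \<beta> $ i\<bar> \<le> \<bar>R\<bar>" for i
      by (simp add: X_def)
    then have "X \<alpha> \<beta> \<in> K"
      by (simp add: K_def mem_box_cart abs_le_iff minus_le_iff)
    then show "G x0 \<le> (\<Sum>j<CARD('k). (filter_combination qu \<beta> \<psi>u j
        + (\<Sum>i<j. filter_combination qy \<alpha> \<psi>y (j - i) * c i) - c j)\<^sup>2)"
      using x0 by (simp add: G_def flip: res_X)
  qed
qed

text \<open>This is \<open>y^2 \<le> 2 * x^2 + 2 * (x - y)^2\<close>, whose two sides differ by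
  \<open>(2 * x - y)^2\<close>.\<close>

lemma square_ge_half_square_minus:
  fixes x y :: real
  assumes "\<bar>x - y\<bar> \<le> d"
  shows "x\<^sup>2 \<ge> y\<^sup>2 / 2 - d\<^sup>2"
proof -
  have "(x - y)\<^sup>2 \<le> d\<^sup>2"
    using assms by (metis abs_ge_zero power2_abs power_mono)
  moreover have "0 \<le> (2 * x - y)\<^sup>2"
    by simp
  ultimately show ?thesis
    by (simp add: power2_eq_square algebra_simps)
qed

section \<open>The uniform lower bound on the mean squared error\<close>

theorem proposition11:
  fixes R :: real
    and qy qu :: nat
    and \<psi>y \<psi>u :: "nat \<Rightarrow> nat \<Rightarrow> real"
  assumes "\<And>r. r \<in> {1..qy} \<Longrightarrow> \<psi>y r \<in> ell1 {1..}"
    and "\<And>r. r \<in> {1..qy} \<Longrightarrow> ell1_norm {1..} (\<psi>y r) \<le> 1"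
    and "\<And>a. a \<in> {1..qu} \<Longrightarrow> \<psi>u a \<in> ell1 {0..}"
    and "\<And>a. a \<in> {1..qu} \<Longrightarrow> ell1_norm {0..} (\<psi>u a) \<le> 1"
    and "qy + qu < CARD('k::finite)"
  shows "\<exists>(A :: real ^ 'k ^ 'k) (B :: real ^ 1 ^ 'k) (C :: real ^ 'k ^ 1) (u :: nat \<Rightarrow> real).
           matrix_inf_norm A \<le> 1 \<and> matrix_inf_norm B \<le> 1 \<and> matrix_inf_norm C \<le> 1 \<and>
           bounded (u ` {1..}) \<and>
           (\<forall>t\<ge>1. \<bar>lds_output A B C u t\<bar> \<le> 1) \<and>
           liminf (\<lambda>T. INF f\<in>GUF R qy \<psi>y qu \<psi>u.
             ereal (1 / real T *
               (\<Sum>t=1..T. \<bar>f u (lds_output A B C u) t - lds_output A B C u t\<bar> ^ 2))) > 0"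
proof -
  define k where "k = CARD('k)"
  have "k > 0"
    by (simp add: k_def)
  obtain e :: "'k \<Rightarrow> nat" where e: "bij_betw e UNIV {..<CARD('k)}"
    using ex_bij_betw_finite_nat[OF finite_class.finite_UNIV] by (auto simp: atLeast0LessThan)
  obtain c :: "nat \<Rightarrow> real" and \<delta> :: real
    where c_sum: "(\<Sum>i<k. \<bar>c i\<bar>) \<le> 1" and "\<delta> > 0"
    and \<delta>: "\<And>\<alpha> \<beta>. (\<Sum>r=1..qy. \<bar>\<alpha> r\<bar>) + (\<Sum>a=1..qu. \<bar>\<beta> a\<bar>) \<le> R \<Longrightarrow>
      \<delta> \<le> (\<Sum>j<k. (filter_combination qu \<beta> \<psi>u j
        + (\<Sum>i<j. filter_combination qy \<alpha> \<psi>y (j - i) * c i) - c j)\<^sup>2)"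
    by (rule unpredictable_impulse_response[OF assms(5) e,
        where \<psi>y = \<psi>y and \<psi>u = \<psi>u and R = R, folded k_def])
      (erule (1) that, blast)
  have c_le: "\<bar>c i\<bar> \<le> 1" if "i < k" for i
    using member_le_sum[of i "{..<k}" "\<lambda>i. \<bar>c i\<bar>"] that c_sum by simp
  obtain A :: "real ^ 'k ^ 'k" and B :: "real ^ 1 ^ 'k" and C :: "real ^ 'k ^ 1"
    where ABC: "matrix_inf_norm A \<le> 1" "matrix_inf_norm B \<le> 1" "matrix_inf_norm C \<le> 1"
    and out: "\<And>u t. lds_output A B C u t = (\<Sum>i<k. if i < t then c i * u (t - i) else 0)"
    by (rule shift_lds_realization[OF e c_sum[unfolded k_def], folded k_def])
      (erule (2) that, blast)
  \<comment> \<open>Chosen so that errors of size \<open>R * \<epsilon>\<close> at the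
    \<open>k\<close> positions of a window cost at most \<open>\<delta> / 4\<close> in total;
    \<open>R\<^sup>2 + 1\<close> keeps the denominator positive when \<open>R = 0\<close>.\<close>
  define \<epsilon> where "\<epsilon> = sqrt (\<delta> / (4 * real k * (R\<^sup>2 + 1)))"
  have "R\<^sup>2 + 1 > 0"
    by (simp add: add_nonneg_pos)
  then have "\<epsilon> > 0" and \<epsilon>2: "\<epsilon>\<^sup>2 = \<delta> / (4 * real k * (R\<^sup>2 + 1))"
    using \<open>\<delta> > 0\<close> \<open>k > 0\<close> by (simp_all add: \<epsilon>_def)
  have "real k * (R * \<epsilon>)\<^sup>2 = (\<delta> / 4) * (R\<^sup>2 / (R\<^sup>2 + 1))"
    using \<open>k > 0\<close> by (simp add: power_mult_distrib \<epsilon>2)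
  also have "\<dots> \<le> (\<delta> / 4) * 1"
    using \<open>\<delta> > 0\<close> \<open>R\<^sup>2 + 1 > 0\<close> by (intro mult_left_mono) auto
  finally have \<epsilon>_small: "real k * (R * \<epsilon>)\<^sup>2 \<le> \<delta> / 4"
    by simp
  have "\<exists>M. \<forall>r\<in>{1..qy}. \<forall>m\<ge>M. \<forall>n. (\<Sum>\<tau>\<in>{m..<n}. \<bar>\<psi>y r \<tau>\<bar>) \<le> \<epsilon>"
    using ell1_imp_summable[OF assms(1)] \<open>\<epsilon> > 0\<close> by (intro summable_uniform_tails) auto
  then obtain My where My: "\<And>r m n. r \<in> {1..qy} \<Longrightarrow> m \<ge> My \<Longrightarrow> (\<Sum>\<tau>\<in>{m..<n}. \<bar>\<psi>y r \<tau>\<bar>) \<le> \<epsilon>"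
    by blast
  have "\<exists>M. \<forall>a\<in>{1..qu}. \<forall>m\<ge>M. \<forall>n. (\<Sum>\<tau>\<in>{m..<n}. \<bar>\<psi>u a \<tau>\<bar>) \<le> \<epsilon>"
    using ell1_imp_summable[OF assms(3)] \<open>\<epsilon> > 0\<close> by (intro summable_uniform_tails) auto
  then obtain Mu where Mu: "\<And>a m n. a \<in> {1..qu} \<Longrightarrow> m \<ge> Mu \<Longrightarrow> (\<Sum>\<tau>\<in>{m..<n}. \<bar>\<psi>u a \<tau>\<bar>) \<le> \<epsilon>"
    by blast
  \<comment> \<open>\<open>M\<close> dominates both tail thresholds and also \<open>k\<close>, so
    that every offset \<open>j < k\<close> lies below it.\<close>
  define M where "M = k + My + Mu"
  define N where "N = M + k"
  define u :: "nat \<Rightarrow> real" where "u = (\<lambda>t. of_bool (N dvd (t - 1)))"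
  define y where "y = lds_output A B C u"
  have "N > 0"
    using \<open>k > 0\<close> by (simp add: N_def)
  have y: "y t = (if (t - 1) mod N < k then c ((t - 1) mod N) else 0)" if "t \<ge> 1" for t
    using impulse_train_output[of k N t c] that by (simp add: y_def out u_def N_def cong: if_cong)
  \<comment> \<open>Each complete window contributes at least \<open>\<delta> / 4\<close>, and
    \<open>T \<ge> N\<close> leaves at least \<open>T / (2 * N)\<close> complete windows, whence the
    factor 8.\<close>
  have mean_error: "\<delta> / (8 * real N) \<le> 1 / real T * (\<Sum>t=1..T. \<bar>f u y t - y t\<bar> ^ 2)"
    if f_GUF: "f \<in> GUF R qy \<psi>y qu \<psi>u" and "T \<ge> N" for f T
  proof -
    obtain \<alpha> \<beta> where
      f: "f = (\<lambda>u y t. (\<Sum>r=1..qy. \<alpha> r * output_conv (\<psi>y r) y t)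
             + (\<Sum>a=1..qu. \<beta> a * input_conv (\<psi>u a) u t))"
      and R: "(\<Sum>r=1..qy. \<bar>\<alpha> r\<bar>) + (\<Sum>a=1..qu. \<bar>\<beta> a\<bar>) \<le> R"
      using f_GUF unfolding GUF_def by blast
    define p where "p = filter_combination qy \<alpha> \<psi>y"
    define b where "b = filter_combination qu \<beta> \<psi>u"
    define res where "res j = b j + (\<Sum>i<j. p (j - i) * c i) - c j" for j
    have f': "f u y t = output_conv p y t + input_conv b u t" for t
      by (simp add: f p_def b_def output_conv_filter_combination input_conv_filter_combination)
    have "\<bar>(f u y (Suc (m * N + j)) - y (Suc (m * N + j))) - res j\<bar> \<le> R * \<epsilon>" if "j < k" for m j
    proof -
      let ?t = "Suc (m * N + j)"
      have "\<bar>(f u y ?t - y ?t) - res j\<bar> \<le> (\<Sum>\<tau>\<in>{M..<?t}. \<bar>p \<tau>\<bar>) + (\<Sum>\<tau>\<in>{M..<?t}. \<bar>b \<tau>\<bar>)"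
        unfolding f' res_def unfolding u_def N_def
        by (rule impulse_train_prediction_error) (use that c_le y in \<open>auto simp: M_def N_def\<close>)
      also have "\<dots> \<le> (\<Sum>r=1..qy. \<bar>\<alpha> r\<bar>) * \<epsilon> + (\<Sum>a=1..qu. \<bar>\<beta> a\<bar>) * \<epsilon>"
        unfolding p_def b_def by (intro add_mono filter_combination_tail My Mu) (auto simp: M_def)
      also have "\<dots> \<le> R * \<epsilon>"
        using R \<open>\<epsilon> > 0\<close> by (simp flip: distrib_right)
      finally show ?thesis .
    qed
    then have sq: "(res j)\<^sup>2 / 2 - (R * \<epsilon>)\<^sup>2 \<le> \<bar>f u y (Suc (m * N + j)) - y (Suc (m * N + j))\<bar> ^ 2"
      if "j < k" for m j
      using that by (simp add: square_ge_half_square_minus)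
    have window: "\<delta> / 4 \<le> (\<Sum>j<k. \<bar>f u y (Suc (m * N + j)) - y (Suc (m * N + j))\<bar> ^ 2)" for m
    proof -
      \<comment> \<open>Half of the ideal error is at least \<open>\<delta> / 2\<close>, and the
        tails take away at most \<open>\<delta> / 4\<close>.\<close>
      have "\<delta> / 4 \<le> (\<Sum>j<k. (res j)\<^sup>2) / 2 - real k * (R * \<epsilon>)\<^sup>2"
        using \<delta>[OF R] \<epsilon>_small by (simp add: res_def p_def b_def)
      also have "\<dots> = (\<Sum>j<k. (res j)\<^sup>2 / 2 - (R * \<epsilon>)\<^sup>2)"
        by (simp add: sum_subtractf sum_divide_distrib)
      also have "\<dots> \<le> (\<Sum>j<k. \<bar>f u y (Suc (m * N + j)) - y (Suc (m * N + j))\<bar> ^ 2)"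
        using sq by (intro sum_mono) simp
      finally show ?thesis .
    qed
    define n where "n = T div N"
    have "n > 0" "T < Suc n * N"
      using \<open>T \<ge> N\<close> \<open>N > 0\<close> by (simp_all add: n_def div_greater_zero_iff dividend_less_div_times)
    moreover have "Suc n * N \<le> 2 * n * N"
      using \<open>n > 0\<close> by (intro mult_le_mono1) simp
    ultimately have "T \<le> 2 * n * N"
      by linarith
    then have "real T \<le> 2 * real n * real N"
      by (metis of_nat_le_iff of_nat_mult of_nat_numeral)
    then have "real T * \<delta> \<le> 2 * real n * real N * \<delta>"
      using \<open>\<delta> > 0\<close> by simp
    then have "\<delta> / (8 * real N) * real T \<le> real n * (\<delta> / 4)"
      using \<open>N > 0\<close> by (simp add: field_simps)
    also have "\<dots> \<le> (\<Sum>t=1..n * N. \<bar>f u y t - y t\<bar> ^ 2)"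
      using window by (intro sum_over_windows_ge[where k = k]) (auto simp: N_def)
    also have "\<dots> \<le> (\<Sum>t=1..T. \<bar>f u y t - y t\<bar> ^ 2)"
      using div_times_less_eq_dividend[of T N] by (intro sum_mono2) (auto simp: n_def)
    finally show ?thesis
      using \<open>T \<ge> N\<close> \<open>N > 0\<close> by (simp add: field_simps)
  qed
  have "0 < ereal (\<delta> / (8 * real N))"
    using \<open>\<delta> > 0\<close> \<open>N > 0\<close> by simp
  \<comment> \<open>The bound depends neither on \<open>f\<close> nor on \<open>T \<ge> N\<close>,
    so it passes to the infimum and then to the limit inferior.\<close>
  also have "\<dots> \<le> liminf (\<lambda>T. INF f\<in>GUF R qy \<psi>y qu \<psi>u.
      ereal (1 / real T * (\<Sum>t=1..T. \<bar>f u y t - y t\<bar> ^ 2)))"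
    using mean_error by (intro Liminf_bounded eventually_sequentiallyI[of N] INF_greatest) simp
  finally have "liminf (\<lambda>T. INF f\<in>GUF R qy \<psi>y qu \<psi>u.
      ereal (1 / real T * (\<Sum>t=1..T. \<bar>f u y t - y t\<bar> ^ 2))) > 0" .
  moreover have "\<bar>y t\<bar> \<le> 1" if "t \<ge> 1" for t
    using c_le by (simp add: y[OF that])
  moreover have "bounded (u ` {1..})"
    by (rule boundedI[of _ 1]) (auto simp: u_def)
  ultimately show ?thesis
    using ABC unfolding y_def by (intro exI[of _ A] exI[of _ B] exI[of _ C] exI[of _ u]) simp
qed

end
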